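(* Let $q,c\in\mathbb{C}$ with $q\neq 0$, and let $n_1,m_1,n_2,m_2$ be positive integers such that either $n_1\geq 2$, $m_1\geq 2$ and at least one of $n_1,m_1$ is not equal to $2$, or $n_2\geq 2$, $m_2\geq 2$ and at least one of $n_2,m_2$ is not equal to $2$. Then there are no non-constant entire solutions $(w_1(z),w_2(z))$ of the system $$\begin{cases} w_1'(z)^{n_1}+w_2(qz+c)^{m_1}=1,\\ w_2'(z)^{n_2}+w_1(qz+c)^{m_2}=1.\end{cases}$$
   Context: An entire solution is a pair $(w_1,w_2)$ of entire functions on $\mathbb{C}$ satisfying both equations for all $z\in\mathbb{C}$. The pair is non-constant if $w_1$ and $w_2$ are not both constant functions. *)

theory Defs
  imports "HOL-Complex_Analysis.Complex_Analysis"
begin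

definition entire_solution ::
  "complex \<Rightarrow> complex \<Rightarrow> nat \<Rightarrow> nat \<Rightarrow> nat \<Rightarrow> nat \<Rightarrow>
    (complex \<Rightarrow> complex) \<Rightarrow> (complex \<Rightarrow> complex) \<Rightarrow> bool" where
  "entire_solution q c n1 m1 n2 m2 w1 w2 \<longleftrightarrow>
     w1 holomorphic_on UNIV \<and> w2 holomorphic_on UNIV \<and>
     (\<forall>z. deriv w1 z ^ n1 + w2 (q * z + c) ^ m1 = 1 \<and>
          deriv w2 z ^ n2 + w1 (q * z + c) ^ m2 = 1)"

definition nonconstant_pair ::
  "(complex \<Rightarrow> complex) \<Rightarrow> (complex \<Rightarrow> complex) \<Rightarrow> bool" where
  "nonconstant_pair w1 w2 \<longleftrightarrow> \<not> (w1 constant_on UNIV \<and> w2 constant_on UNIV)"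

end

theory Submission
  imports Defs
begin

text \<open>
  If \<open>f\<^sup>n + g\<^sup>m = 1\<close> with \<open>n \<ge> 3\<close>, \<open>m \<ge> 2\<close> and \<open>\<zeta>\<^sup>m = 1\<close>, then \<open>1 - \<zeta> g\<close> is a divisor of \<open>f\<^sup>n\<close> that has no zero
  in common with its cofactor, so it is the \<open>n\<close>-th power of an entire function. Two different values
  of \<open>\<zeta>\<close> give entire functions with \<open>A\<^sup>n + B\<^sup>n\<close> a non-zero constant. Of the \<open>n \<ge> 3\<close> zero-free
  linear factors of \<open>A\<^sup>n + B\<^sup>n\<close>, the quotient of two is a zero-free entire function, and it omits
  a second value because of the third factor; by Picard it is constant, and so are \<open>A\<close>, \<open>B\<close> and \<open>g\<close>.
  Hence one equation of the system forces one unknown and the derivative of the other to be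
  constant, and the second equation does the rest.
\<close>

section \<open>Constancy, zeros and roots of entire functions\<close>

lemma entire_constant_if_power_constant:
  fixes f :: "complex \<Rightarrow> complex"
  assumes "f holomorphic_on UNIV" "n > 0" "\<And>z. f z ^ n = C"
  shows "f constant_on UNIV"
proof (rule Liouville_theorem[OF assms(1)])
  \<comment> \<open>Outside the unit disc a positive power only increases the modulus; the bound 1
    covers the inside.\<close>
  have "norm (f z) \<le> max 1 (norm C)" for z
  proof (cases "norm (f z) \<le> 1")
    case False
    then have "norm (f z) ^ 1 \<le> norm (f z) ^ n"
      using assms(2) by (intro power_increasing) auto
    also have "\<dots> = norm C"
      using assms(3)[of z] by (simp add: norm_power[symmetric])
    finally show ?thesis by simp
  qed simp
  then show "bounded (range f)"
    by (auto simp: bounded_iff)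
qed

lemma entire_zeros_not_islimpt:
  assumes "f holomorphic_on UNIV" "f w \<noteq> 0"
  shows "\<not> z islimpt {z. f z = 0}"
proof
  assume "z islimpt {z. f z = 0}"
  then have "f w = 0"
    by (rule analytic_continuation[OF assms(1) open_UNIV connected_UNIV subset_UNIV UNIV_I]) auto
  with assms(2) show False by simp
qed

lemma entire_frequently_nonzero:
  fixes f :: "complex \<Rightarrow> complex"
  assumes "f holomorphic_on UNIV" "f w \<noteq> 0"
  shows "frequently (\<lambda>z. f z \<noteq> 0) (at z)"
  using entire_zeros_not_islimpt[OF assms, of z]
  by (intro eventually_frequently) (auto simp: islimpt_iff_eventually)

lemma countable_entire_zeros:
  assumes "f holomorphic_on UNIV" "f w \<noteq> 0"
  shows "countable {z. f z = 0}"
proof (cases "f constant_on UNIV")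
  case True
  then have "{z. f z = 0} = {}"
    using assms(2) by (auto simp: constant_on_def)
  then show ?thesis by simp
next
  case False
  then show ?thesis
    using holomorphic_countable_zeros[OF assms(1)] fsigma.intros[of "\<lambda>_. UNIV :: complex set"]
    by (simp add: connected_UNIV)
qed

text \<open>The plane is contractible, so \<open>f\<close> has an entire logarithm; dividing it by
  \<open>n\<close> gives the root.\<close>

lemma zero_free_entire_has_root:
  fixes f :: "complex \<Rightarrow> complex"
  assumes "f holomorphic_on UNIV" "\<And>z. f z \<noteq> 0" "n > 0"
  obtains r where "r holomorphic_on UNIV" "\<And>z. f z = r z ^ n"
proof -
  obtain l where l: "l holomorphic_on UNIV" "\<And>z. f z = exp (l z)"
    using contractible_imp_holomorphic_log[OF assms(1) contractible_UNIV] assms(2) by auto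
  show thesis
  proof
    show "(\<lambda>z. exp (l z / of_nat n)) holomorphic_on UNIV"
      using assms(3) by (intro holomorphic_intros l) auto
    show "f z = exp (l z / of_nat n) ^ n" for z
      using assms(3) by (simp add: l(2) exp_of_nat_mult[symmetric])
  qed
qed

section \<open>Coprime factors of an n-th power\<close>

text \<open>
  Weierstrass factorization of \<open>f\<close> on the complement of the zeros of \<open>v\<close> singles out the zeros that
  belong to \<open>u\<close>, so it yields an entire \<open>F\<close> for which \<open>F\<^sup>n\<close> and \<open>u\<close> have the same zero orders.
\<close>

lemma entire_coprime_factor_of_power:
  fixes f u v :: "complex \<Rightarrow> complex"
  assumes f: "f holomorphic_on UNIV" and u: "u holomorphic_on UNIV" and v: "v holomorphic_on UNIV"
    and n: "n > 0"
    and eq: "\<And>z. f z ^ n = u z * v z"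
    and coprime: "\<And>z. u z \<noteq> 0 \<or> v z \<noteq> 0"
  obtains r where "r holomorphic_on UNIV" "\<And>z. u z = r z ^ n"
proof -
  \<comment> \<open>If \<open>v\<close> vanishes identically, coprimality makes \<open>u\<close>
    zero-free; only the third case needs Weierstrass.\<close>
  consider "\<And>z. u z = 0" | "\<And>z. v z = 0" | z1 z2 where "u z1 \<noteq> 0" "v z2 \<noteq> 0"
    by blast
  then show thesis
  proof cases
    case 1
    then show thesis
      using n by (intro that[of "\<lambda>_. 0"]) auto
  next
    case 2
    then have "u z \<noteq> 0" for z
      using coprime by blast
    then show thesis
      using zero_free_entire_has_root[OF u _ n] that by blast
  next
    case 3
    define A where "A = {z. v z \<noteq> 0}"
    have closed: "closed {z. v z = 0}"
      using holomorphic_on_imp_continuous_on[OF v]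
      by (auto intro!: closed_Collect_eq)
    have A: "A = UNIV - {z. v z = 0}" by (auto simp: A_def)
    have "open A"
      using closed by (auto simp: A)
    have ctbl: "countable {z. v z = 0}"
      using countable_entire_zeros[OF v 3(2)] .
    \<comment> \<open>Deleting countably many points does not disconnect the plane.\<close>
    then have "connected A"
      unfolding A by (intro connected_open_diff_countable) auto
    have "countable ({z. u z = 0} \<union> {z. v z = 0})"
      using ctbl countable_entire_zeros[OF u 3(1)] by simp
    \<comment> \<open>Two countable zero sets cannot cover the plane, so \<open>f\<close> is not
      identically zero.\<close>
    then have "{z. u z = 0} \<union> {z. v z = 0} \<noteq> UNIV"
      using uncountable_UNIV_complex by metis
    then obtain w0 where uv: "u w0 * v w0 \<noteq> 0"
      by auto
    then have w0: "f w0 \<noteq> 0"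
      using eq[of w0] n by (auto simp: power_0_left)
    show thesis
    proof (rule weierstrass_factorization[of f A])
      show "f holomorphic_on A" using f by (rule holomorphic_on_subset) auto
      show "open A" "connected A" by fact+
      show "\<not> z islimpt {w \<in> A. f w = 0}" for z
        using entire_zeros_not_islimpt[OF f w0, of z] islimpt_subset[of z _ "{w. f w = 0}"] by blast
    next
      fix h F
      assume F: "F holomorphic_on UNIV"
        "\<forall>z. F z = 0 \<longleftrightarrow> (\<forall>z\<in>A. f z = 0) \<or> (z \<in> A \<and> f z = 0)"
        "\<forall>z\<in>A. zorder F z = zorder f z"
      \<comment> \<open>The first alternative for the zeros of \<open>F\<close> means that
        \<open>f\<close> vanishes on all of \<open>A\<close>; \<open>w0\<close> rules it
        out.\<close>
      have nz: "\<exists>z\<in>A. f z \<noteq> 0"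
        using uv w0 by (auto simp: A_def)
      have F0: "F z = 0 \<longleftrightarrow> u z = 0" for z
      proof -
        have "F z = 0 \<longleftrightarrow> z \<in> A \<and> f z = 0"
          using F(2) nz by blast
        also have "f z = 0 \<longleftrightarrow> u z * v z = 0"
          using eq[of z] n power_eq_0_iff[of "f z" n] by simp
        finally show ?thesis
          using coprime[of z] by (auto simp: A_def)
      qed
      note analytic = holomorphic_on_imp_analytic_at[OF _ open_UNIV UNIV_I]
      note analytic_F = analytic[OF F(1)] and analytic_f = analytic[OF f]
        and analytic_u = analytic[OF u] and analytic_v = analytic[OF v]
      \<comment> \<open>At a zero of \<open>u\<close> the cofactor \<open>v\<close> has order 0, so
        all of the order of \<open>f ^ n\<close> comes from \<open>u\<close>.\<close>
      have ord: "zorder (\<lambda>z. F z ^ n) z = zorder u z" for z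
      proof (cases "u z = 0")
        case False
        then have "F z ^ n \<noteq> 0"
          using F0 by simp
        then have "zorder (\<lambda>z. F z ^ n) z = 0"
          by (intro zorder_eq_0I analytic_on_power analytic_F)
        also have "0 = zorder u z"
          using False by (intro zorder_eq_0I[symmetric] analytic_u)
        finally show ?thesis .
      next
        case True
        then have vz: "v z \<noteq> 0" using coprime by blast
        have "zorder (\<lambda>z. F z ^ n) z = n * zorder F z"
          using 3(1) F0 by (intro zorder_power analytic_on_imp_meromorphic_on analytic_F
              entire_frequently_nonzero[OF F(1)]) blast+
        also have "zorder F z = zorder f z"
          using F(3) vz by (simp add: A_def)
        also have "n * zorder f z = zorder (\<lambda>z. f z ^ n) z"
          by (intro zorder_power[symmetric] analytic_on_imp_meromorphic_on analytic_f
              entire_frequently_nonzero[OF f w0])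
        also have "\<dots> = zorder (\<lambda>z. u z * v z) z"
          by (simp add: eq)
        also have "\<dots> = zorder u z + zorder v z"
          by (intro zorder_times_analytic' isolated_singularity_at_analytic not_essential_analytic
              analytic_u analytic_v entire_frequently_nonzero[where w = w0] holomorphic_intros u v uv)
        also have "zorder v z = 0"
          by (intro zorder_eq_0I analytic_v vz)
        finally show ?thesis by simp
      qed
      \<comment> \<open>Equal orders leave a zero-free quotient \<open>h\<close>, whose n-th root is
        absorbed into \<open>F\<close>.\<close>
      obtain h where h: "h holomorphic_on UNIV" "\<And>z. h z \<noteq> 0" "\<And>z. u z = h z * F z ^ n"
      proof (rule holomorphic_zorder_factorization[of u UNIV "\<lambda>z. F z ^ n"])
        show "(\<lambda>z. F z ^ n) holomorphic_on UNIV"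
          by (intro holomorphic_intros F(1))
        show "F z ^ n = 0 \<longleftrightarrow> u z = 0" for z
          using F0 n by simp
      qed (use u ord in auto)
      obtain k where k: "k holomorphic_on UNIV" "\<And>z. h z = k z ^ n"
        using zero_free_entire_has_root[OF h(1,2) n] by blast
      show thesis
      proof
        show "(\<lambda>z. k z * F z) holomorphic_on UNIV"
          by (intro holomorphic_intros k(1) F(1))
        show "u z = (k z * F z) ^ n" for z
          by (simp add: h(3) k(2) power_mult_distrib)
      qed
    qed
  qed
qed

section \<open>The Fermat equation with equal exponents\<close>

lemma entire_fermat_constant:
  fixes a b :: "complex \<Rightarrow> complex"
  assumes a: "a holomorphic_on UNIV" and b: "b holomorphic_on UNIV"
    and n: "n \<ge> 3" and \<kappa>: "\<kappa> \<noteq> 0" and eq: "\<And>z. a z ^ n + b z ^ n = \<kappa>"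
  shows "a constant_on UNIV"
proof -
  have "card {z::complex. z ^ n = -1} = n"
    using n by (intro card_nth_roots) auto
  then obtain S where S: "S \<subseteq> {z::complex. z ^ n = -1}" "card S = 3"
    using n by (metis obtain_subset_with_card_n)
  then obtain r s t where rst: "S = {r,s,t}" "r \<noteq> s" "r \<noteq> t" "s \<noteq> t"
    by (auto simp: card_3_iff)
  have root: "r ^ n = -1" "s ^ n = -1" "t ^ n = -1"
    using S rst by auto
  have nz: "a z - \<rho> * b z \<noteq> 0" if "\<rho> ^ n = -1" for \<rho> z
  proof
    assume "a z - \<rho> * b z = 0"
    then have "a z ^ n = \<rho> ^ n * b z ^ n" by (simp add: power_mult_distrib)
    then show False using eq[of z] \<kappa> that by simp
  qed
  define Q where "Q = (\<lambda>z. (a z - r * b z) / (a z - s * b z))"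
  \<comment> \<open>The value that \<open>Q\<close> would take at a zero of the third factor
    \<open>a - t * b\<close>.\<close>
  define \<tau> where "\<tau> = (t - r) / (t - s)"
  have "Q holomorphic_on UNIV"
    unfolding Q_def using nz[OF root(2)] by (intro holomorphic_intros a b) auto
  moreover have "\<tau> \<noteq> 0"
    using rst by (auto simp: \<tau>_def)
  moreover have "Q z \<noteq> \<tau>" for z
  proof
    assume "Q z = \<tau>"
    then have "(a z - r * b z) * (t - s) = (t - r) * (a z - s * b z)"
      using nz[OF root(2), of z] rst by (simp add: Q_def \<tau>_def field_simps)
    then have "(r - s) * (a z - t * b z) = 0"
      by (simp add: algebra_simps)
    then show False using nz[OF root(3)] rst by simp
  qed
  moreover have "Q z \<noteq> 0" for z
    using nz[OF root(1)] nz[OF root(2)] by (simp add: Q_def)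
  ultimately have "Q holomorphic_on UNIV" "\<tau> \<noteq> 0" "range Q \<inter> {\<tau>, 0} = {}"
    by blast+
  then obtain c where c: "Q = (\<lambda>_. c)"
    by (rule little_Picard)
  \<comment> \<open>With \<open>Q\<close> constant, two linear equations make \<open>a\<close> and
    \<open>b\<close> constant multiples of \<open>V\<close>, so the Fermat equation fixes
    \<open>V ^ n\<close>.\<close>
  define V where "V = (\<lambda>z. (a z - s * b z) / (r - s))"
  have V: "(r - s) * V z = a z - s * b z" for z
    using rst by (simp add: V_def)
  have U: "a z - r * b z = c * ((r - s) * V z)" for z
    using fun_cong[OF c, of z] nz[OF root(2), of z] unfolding V by (simp add: Q_def divide_eq_eq)
  have bV: "b z = (1 - c) * V z" for z
  proof -
    have "(r - s) * b z = (a z - s * b z) - (a z - r * b z)"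
      by (simp add: algebra_simps)
    also have "\<dots> = (r - s) * ((1 - c) * V z)"
      unfolding U V[symmetric] by (simp add: algebra_simps)
    finally show ?thesis using rst by simp
  qed
  have aV: "a z = (r - c * s) * V z" for z
    using U[of z] unfolding bV by (simp add: algebra_simps)
  define K where "K = (r - c * s) ^ n + (1 - c) ^ n"
  have KV: "K * V z ^ n = \<kappa>" for z
    using eq[of z] unfolding aV bV K_def by (simp only: power_mult_distrib distrib_right)
  \<comment> \<open>Here \<open>K\<close> is non-zero because \<open>\<kappa>\<close> is.\<close>
  then have "V z ^ n = \<kappa> / K" for z
    using \<kappa> by (metis mult_zero_left nonzero_mult_div_cancel_left)
  moreover have "V holomorphic_on UNIV"
    unfolding V_def using rst by (intro holomorphic_intros a b) auto
  ultimately have "V constant_on UNIV"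
    using entire_constant_if_power_constant[of V n] n by simp
  then show ?thesis
    by (auto simp: constant_on_def aV)
qed

section \<open>The equation with two different exponents\<close>

lemma entire_power_sum_eq_1_constant_aux:
  fixes f g :: "complex \<Rightarrow> complex"
  assumes f: "f holomorphic_on UNIV" and g: "g holomorphic_on UNIV"
    and n: "n \<ge> 3" and m: "m \<ge> 2" and eq: "\<And>z. f z ^ n + g z ^ m = 1"
  shows "f constant_on UNIV \<and> g constant_on UNIV"
proof -
  have root: "\<exists>r. r holomorphic_on UNIV \<and> (\<forall>z. 1 - \<zeta> * g z = r z ^ n)" if \<zeta>: "\<zeta> ^ m = 1" for \<zeta>
  proof (rule entire_coprime_factor_of_power[of f "\<lambda>z. 1 - \<zeta> * g z" "\<lambda>z. \<Sum>k<m. (\<zeta> * g z) ^ k" n])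
    show "f z ^ n = (1 - \<zeta> * g z) * (\<Sum>k<m. (\<zeta> * g z) ^ k)" for z
    proof -
      have "f z ^ n = 1 - (\<zeta> * g z) ^ m"
        using eq[of z] \<zeta> by (simp add: power_mult_distrib eq_diff_eq)
      then show ?thesis by (simp add: one_diff_power_eq)
    qed
    \<comment> \<open>Where \<open>\<zeta> * g z = 1\<close>, the geometric sum equals
      \<open>m\<close>, which is not zero.\<close>
    show "1 - \<zeta> * g z \<noteq> 0 \<or> (\<Sum>k<m. (\<zeta> * g z) ^ k) \<noteq> 0" for z
      using m by (cases "\<zeta> * g z = 1") auto
  qed (use f g n in \<open>auto intro!: holomorphic_intros\<close>)
  have "card {z::complex. z ^ m = 1} = m"
    using m by (intro card_nth_roots) auto
  then have "\<not> {z::complex. z ^ m = 1} \<subseteq> {1}"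
    using m card_mono[of "{1}" "{z::complex. z ^ m = 1}"] by auto
  then obtain \<zeta> :: complex where \<zeta>: "\<zeta> ^ m = 1" "\<zeta> \<noteq> 1" by auto
  obtain p where p: "p holomorphic_on UNIV" "\<And>z. 1 - g z = p z ^ n"
    using root[of 1] by auto
  obtain s where s: "s holomorphic_on UNIV" "\<And>z. 1 - \<zeta> * g z = s z ^ n"
    using root[OF \<zeta>(1)] by auto
  have "\<zeta> \<noteq> 0" using \<zeta> m by (auto simp: power_0_left)
  \<comment> \<open>Scaling \<open>p\<close> by \<open>\<mu>\<close> cancels \<open>g\<close>:
    \<open>- \<zeta> * (1 - g z) + (1 - \<zeta> * g z) = 1 - \<zeta>\<close>.\<close>
  have "\<exists>\<mu>. \<mu> ^ n = - \<zeta>"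
  proof -
    have "card {\<mu>. \<mu> ^ n = - \<zeta>} = n"
      using \<open>\<zeta> \<noteq> 0\<close> n by (intro card_nth_roots) auto
    then have "{\<mu>. \<mu> ^ n = - \<zeta>} \<noteq> {}"
      using n by (intro notI) simp
    then show ?thesis by blast
  qed
  then obtain \<mu> where \<mu>: "\<mu> ^ n = - \<zeta>" by blast
  then have "\<mu> \<noteq> 0" using \<mu> n \<open>\<zeta> \<noteq> 0\<close> by (auto simp: power_0_left)
  have "(\<lambda>z. \<mu> * p z) constant_on UNIV"
  proof (rule entire_fermat_constant[OF _ s(1) n])
    show "(\<mu> * p z) ^ n + s z ^ n = 1 - \<zeta>" for z
      by (simp add: power_mult_distrib \<mu> algebra_simps flip: p(2) s(2))
  qed (use p \<zeta> in \<open>auto intro!: holomorphic_intros\<close>)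
  then obtain d where "\<And>z. \<mu> * p z = d"
    by (auto simp: constant_on_def)
  then have "p z = d / \<mu>" for z
    using \<open>\<mu> \<noteq> 0\<close> by (metis nonzero_mult_div_cancel_left)
  then have gz: "g z = 1 - (d / \<mu>) ^ n" for z
    using p(2)[of z] by (simp add: algebra_simps)
  then have "f z ^ n = 1 - (1 - (d / \<mu>) ^ n) ^ m" for z
    using eq[of z] unfolding gz by (simp add: eq_diff_eq)
  then have "f constant_on UNIV"
    using entire_constant_if_power_constant[OF f, of n] n by simp
  then show ?thesis
    using gz by (auto simp: constant_on_def)
qed

text \<open>One of the exponents is at least 3, and the equation is symmetric in the two
  powers.\<close>

lemma entire_power_sum_eq_1_constant:
  fixes f g :: "complex \<Rightarrow> complex"
  assumes "f holomorphic_on UNIV" "g holomorphic_on UNIV"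
    and "n \<ge> 2" "m \<ge> 2" "n \<noteq> 2 \<or> m \<noteq> 2" "\<And>z. f z ^ n + g z ^ m = 1"
  shows "f constant_on UNIV \<and> g constant_on UNIV"
proof (cases "n \<ge> 3")
  case True
  then show ?thesis using entire_power_sum_eq_1_constant_aux assms by blast
next
  case False
  then have "m \<ge> 3" using assms by auto
  then show ?thesis
    using entire_power_sum_eq_1_constant_aux[of g f m n] assms by (simp add: add.commute)
qed

section \<open>The system of differential equations\<close>

lemma system_solution_constant:
  fixes w1 w2 :: "complex \<Rightarrow> complex"
  assumes q: "q \<noteq> 0" and w: "w1 holomorphic_on UNIV" "w2 holomorphic_on UNIV"
    and n1: "n1 \<ge> 2" and m1: "m1 \<ge> 2" and ne: "n1 \<noteq> 2 \<or> m1 \<noteq> 2" and n2: "n2 > 0" and m2: "m2 > 0"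
    and eq1: "\<And>z. deriv w1 z ^ n1 + w2 (q * z + c) ^ m1 = 1"
    and eq2: "\<And>z. deriv w2 z ^ n2 + w1 (q * z + c) ^ m2 = 1"
  shows "w1 constant_on UNIV \<and> w2 constant_on UNIV"
proof -
  \<comment> \<open>As \<open>q \<noteq> 0\<close>, the affine shift is onto, so constancy passes
    from shifted functions to the functions themselves.\<close>
  have shift: "z = q * ((z - c) / q) + c" for z
    using q by simp
  have "(\<lambda>z. w2 (q * z + c)) holomorphic_on UNIV"
    using holomorphic_on_compose_gen[of "\<lambda>z. q * z + c" UNIV w2 UNIV] w(2)
    by (simp add: o_def holomorphic_intros)
  then have "(\<lambda>z. w2 (q * z + c)) constant_on UNIV"
    using entire_power_sum_eq_1_constant[of "deriv w1" "\<lambda>z. w2 (q * z + c)" n1 m1]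
      holomorphic_deriv[OF w(1)] n1 m1 ne eq1 by auto
  then obtain d where "\<And>z. w2 (q * z + c) = d"
    by (auto simp: constant_on_def)
  then have w2: "w2 = (\<lambda>_. d)"
    using shift by metis
  \<comment> \<open>The derivative of the constant \<open>w2\<close> is 0, and
    \<open>0 ^ n2 = 0\<close> because \<open>n2 > 0\<close>.\<close>
  then have "w1 (q * z + c) ^ m2 = 1" for z
    using eq2[of z] n2 by (simp add: zero_power)
  then have "w1 z ^ m2 = 1" for z
    using shift by metis
  then have "w1 constant_on UNIV"
    using entire_constant_if_power_constant[OF w(1) m2] by blast
  then show ?thesis
    using w2 by (auto simp: constant_on_def)
qed

theorem theorem3p1:
  fixes q c :: complex and n1 m1 n2 m2 :: nat
  assumes "q \<noteq> 0"
    and "n1 > 0" and "m1 > 0" and "n2 > 0" and "m2 > 0"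
    and "(n1 \<ge> 2 \<and> m1 \<ge> 2 \<and> (n1 \<noteq> 2 \<or> m1 \<noteq> 2)) \<or>
         (n2 \<ge> 2 \<and> m2 \<ge> 2 \<and> (n2 \<noteq> 2 \<or> m2 \<noteq> 2))"
  shows "\<nexists>w1 w2. entire_solution q c n1 m1 n2 m2 w1 w2 \<and> nonconstant_pair w1 w2"
proof -
  \<comment> \<open>Exchanging the two unknowns along with their exponents preserves the system, so
    one lemma covers both alternatives.\<close>
  have "w1 constant_on UNIV \<and> w2 constant_on UNIV"
    if "entire_solution q c n1 m1 n2 m2 w1 w2" for w1 w2
    using assms(6) that system_solution_constant[OF assms(1), of w1 w2 n1 m1 n2 m2 c]
      system_solution_constant[OF assms(1), of w2 w1 n2 m2 n1 m1 c] assms(2-5)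
    by (auto simp: entire_solution_def)
  then show ?thesis
    by (auto simp: nonconstant_pair_def)
qed

end
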